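(* Let $X$ be a uniformly discrete metric space with bounded geometry and let $X_1\subseteq X_2\subseteq X_3\subseteq\cdots$ be an increasing sequence of bounded subspaces of $X$ (with the restricted metric) such that $X=\bigcup_{n=1}^\infty X_n$. Assume that every bounded subset of $X$ is contained in some $X_n$. If the family $\{X_n\}_{n=1}^\infty$ is equi-strongly embeddable, then $X$ is strongly embeddable.
   Context: Bounded geometry: a metric space $X$ has bounded geometry if for all $R>0$ there is $N_R$ with $|B(x,R)|\le N_R$ for all $x\in X$. Uniformly discrete: there is $C>0$ with $d(x,y)\ge C$ for all distinct $x,y$. Balls: $B(x,S)=\{y: d(x,y)\le S\}$. Strong embeddability: a metric space $X$ is strongly embeddable if for all $R,\epsilon>0$ there is a map $\beta:X\to \ell^2(X)$, $x\mapsto\beta_x$, with $\|\beta_x\|=1$ for all $x$, such that (1) $d(x,y)\le R$ implies $\|\beta_x-\beta_y\|\le\epsilon$ (called $(R,\epsilon)$ variation); (2) $\lim_{S\to\infty}\sup_{x\in X}\sum_{w\notin B(x,S)}|\beta_x(w)|^2=0$. Equi-strong embeddability: a family $(X_i)_{i\in I}$ of metric spaces is equi-strongly embeddable if for all $R,\epsilon>0$ there are maps $\xi^i:X_i\to\ell^2(X_i)$, $x\mapsto\xi^i_x$, with $\|\xi^i_x\|=1$, such that (1) each $\xi^i$ has $(R,\epsilon)$ variation; (2) $\lim_{S\to\infty}\sup_{i\in I}\sup_{x\in X_i}\sum_{w\in X_i\setminus B(x,S)}|\xi^i_x(w)|^2=0$. *)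

theory Defs
  imports "HOL-Analysis.Analysis"
begin

text \<open>
  \<open>\<ell>\<^sup>2(X)\<close> for a set \<open>X\<close>, as square-summable complex functions on \<open>X\<close>, extended by 0 outside
  \<open>X\<close>.
\<close>

definition ell2 :: "'a set \<Rightarrow> ('a \<Rightarrow> complex) set" where
  "ell2 X = {f. (\<forall>w. w \<notin> X \<longrightarrow> f w = 0) \<and> (\<lambda>w. (cmod (f w))\<^sup>2) summable_on X}"

definition ell2_norm :: "'a set \<Rightarrow> ('a \<Rightarrow> complex) \<Rightarrow> real" where
  "ell2_norm X f = sqrt (\<Sum>\<^sub>\<infinity>w\<in>X. (cmod (f w))\<^sup>2)"

definition (in Metric_space) uniformly_discrete :: bool where
  "uniformly_discrete \<longleftrightarrow> (\<exists>C>0. \<forall>x\<in>M. \<forall>y\<in>M. x \<noteq> y \<longrightarrow> C \<le> d x y)"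

text \<open>Finiteness has to be required separately, since \<open>card\<close> is 0 on infinite sets.\<close>

definition (in Metric_space) bounded_geometry :: bool where
  "bounded_geometry \<longleftrightarrow>
    (\<forall>R>0. \<exists>N. \<forall>x\<in>M. finite (mcball x R) \<and> card (mcball x R) \<le> N)"

definition (in Metric_space) has_variation ::
    "real \<Rightarrow> real \<Rightarrow> ('a \<Rightarrow> 'a \<Rightarrow> complex) \<Rightarrow> bool" where
  "has_variation R \<epsilon> \<beta> \<longleftrightarrow>
    (\<forall>x\<in>M. \<forall>y\<in>M. d x y \<le> R \<longrightarrow> ell2_norm M (\<lambda>w. \<beta> x w - \<beta> y w) \<le> \<epsilon>)"

text \<open>
  The supremum is taken in \<^typ>\<open>ennreal\<close>, so that it is 0 (and not an unspecified real)
  for the empty space.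
\<close>

definition (in Metric_space) tail_sup :: "('a \<Rightarrow> 'a \<Rightarrow> complex) \<Rightarrow> real \<Rightarrow> ennreal" where
  "tail_sup \<beta> S = (SUP x\<in>M. ennreal (\<Sum>\<^sub>\<infinity>w\<in>M - mcball x S. (cmod (\<beta> x w))\<^sup>2))"

definition (in Metric_space) strongly_embeddable :: bool where
  "strongly_embeddable \<longleftrightarrow>
    (\<forall>R>0. \<forall>\<epsilon>>0. \<exists>\<beta>.
      (\<forall>x\<in>M. \<beta> x \<in> ell2 M \<and> ell2_norm M (\<beta> x) = 1) \<and>
      has_variation R \<epsilon> \<beta> \<and>
      (tail_sup \<beta> \<longlongrightarrow> 0) at_top)"

definition equi_strongly_embeddable ::
    "'i set \<Rightarrow> ('i \<Rightarrow> 'a set) \<Rightarrow> ('i \<Rightarrow> 'a \<Rightarrow> 'a \<Rightarrow> real) \<Rightarrow> bool" where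
  "equi_strongly_embeddable I X d \<longleftrightarrow>
    (\<forall>R>0. \<forall>\<epsilon>>0. \<exists>\<xi>.
      (\<forall>i\<in>I. \<forall>x\<in>X i. \<xi> i x \<in> ell2 (X i) \<and> ell2_norm (X i) (\<xi> i x) = 1) \<and>
      (\<forall>i\<in>I. Metric_space.has_variation (X i) (d i) R \<epsilon> (\<xi> i)) \<and>
      ((\<lambda>S. SUP i\<in>I. Metric_space.tail_sup (X i) (d i) (\<xi> i) S) \<longlongrightarrow> 0) at_top)"

end

theory Submission
  imports Defs "HOL-Complex_Analysis.Great_Picard"
begin

text \<open>
  Choose unit vectors \<open>\<xi> n x \<in> \<ell>\<^sup>2(Xs n)\<close> with \<open>(R, \<epsilon>)\<close> variation and uniformly small tails. As \<open>X\<close>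
  is countable, a diagonal argument yields a subsequence along which \<open>\<xi> n x w\<close> converges for all
  \<open>x, w \<in> X\<close>; let \<open>\<beta> x w\<close> be the limit. By Fatou's lemma, \<open>\<beta>\<close> inherits the bounds on norms,
  variation and tails. No mass is lost in the limit, because for each \<open>x\<close> all but an arbitrarily
  small part of the mass of every \<open>\<xi> n x\<close> lies in one ball around \<open>x\<close>, which is finite.
\<close>

section \<open>Square sums: Fatou's lemma and change of the index set\<close>

text \<open>A sum of nonnegative terms is the supremum of its finite partial sums, and each finite
  partial sum of \<open>h\<close> is the limit of those of \<open>g n\<close>, which are eventually
  at most \<open>c\<close>. Summability is part of \<open>bound\<close> because
  \<open>infsum\<close> is 0 on families that are not summable.\<close>

lemma infsum_Fatou:
  fixes g :: "nat \<Rightarrow> 'a \<Rightarrow> real"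
  assumes lim: "\<And>w. w \<in> A \<Longrightarrow> (\<lambda>n. g n w) \<longlonglongrightarrow> h w"
    and nonneg: "\<And>n w. w \<in> A \<Longrightarrow> 0 \<le> g n w"
    and bound: "\<forall>\<^sub>F n in sequentially. g n summable_on A \<and> infsum (g n) A \<le> c"
  shows "h summable_on A" and "infsum h A \<le> c"
proof -
  have fin: "sum h F \<le> c" if F: "finite F" "F \<subseteq> A" for F
  proof (rule tendsto_upperbound)
    show "(\<lambda>n. sum (g n) F) \<longlonglongrightarrow> sum h F"
      using F by (intro tendsto_sum lim) auto
    show "\<forall>\<^sub>F n in sequentially. sum (g n) F \<le> c"
      using bound
    proof eventually_elim
      case (elim n)
      have "sum (g n) F \<le> infsum (g n) A"
        using elim F nonneg by (intro finite_sum_le_infsum) auto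
      with elim show ?case by linarith
    qed
  qed simp
  have "0 \<le> h w" if "w \<in> A" for w
    using lim[OF that] nonneg[OF that] by (intro LIMSEQ_le_const) auto
  then show *: "h summable_on A"
    using fin by (intro nonneg_bdd_above_summable_on) (auto intro!: bdd_aboveI)
  show "infsum h A \<le> c"
    using * fin by (intro infsum_le_finite_sums) auto
qed

lemma cmod_diff_power2_le: "(cmod (a - b))\<^sup>2 \<le> 2 * (cmod a)\<^sup>2 + 2 * (cmod b)\<^sup>2"
proof -
  have "(cmod (a - b))\<^sup>2 \<le> (cmod a + cmod b)\<^sup>2"
    by (intro power_mono norm_triangle_ineq4) simp
  also have "\<dots> \<le> 2 * (cmod a)\<^sup>2 + 2 * (cmod b)\<^sup>2"
    \<comment> \<open>The right side minus the left side is
      \<open>(cmod a - cmod b)^2\<close>.\<close>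
    using zero_le_power2[of "cmod a - cmod b"] by (simp add: power2_sum power2_diff)
  finally show ?thesis .
qed

lemma ell2_diff:
  assumes "f \<in> ell2 X" "g \<in> ell2 X"
  shows "(\<lambda>w. f w - g w) \<in> ell2 X"
proof -
  have "(\<lambda>w. 2 * (cmod (f w))\<^sup>2 + 2 * (cmod (g w))\<^sup>2) summable_on X"
    using assms by (intro summable_on_add summable_on_cmult_right) (auto simp: ell2_def)
  then have "(\<lambda>w. (cmod (f w - g w))\<^sup>2) summable_on X"
    by (rule summable_on_comparison_test) (auto intro: cmod_diff_power2_le)
  then show ?thesis
    using assms by (simp add: ell2_def)
qed

text \<open>Functions in \<open>ell2 Y\<close> vanish off \<open>Y\<close>, so a sum over
  \<open>A\<close> sees only \<open>A \<inter> Y\<close>. This moves sums over the varying sets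
  \<open>Xs n\<close> to the fixed space \<open>M\<close>, where limits in \<open>n\<close> can be
  taken.\<close>

lemma ell2_extend:
  assumes "f \<in> ell2 Y"
  shows "(\<lambda>w. (cmod (f w))\<^sup>2) summable_on A"
    and "(\<Sum>\<^sub>\<infinity>w\<in>A. (cmod (f w))\<^sup>2) = (\<Sum>\<^sub>\<infinity>w\<in>A \<inter> Y. (cmod (f w))\<^sup>2)"
proof -
  have zero: "f w = 0" if "w \<notin> Y" for w
    using assms that by (simp add: ell2_def)
  have "(\<lambda>w. (cmod (f w))\<^sup>2) summable_on A \<inter> Y"
    using assms by (auto simp: ell2_def intro: summable_on_subset_banach)
  then show "(\<lambda>w. (cmod (f w))\<^sup>2) summable_on A"
    by (rule summable_on_cong_neutral[THEN iffD1, rotated -1]) (auto simp: zero)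
  show "(\<Sum>\<^sub>\<infinity>w\<in>A. (cmod (f w))\<^sup>2) = (\<Sum>\<^sub>\<infinity>w\<in>A \<inter> Y. (cmod (f w))\<^sup>2)"
    by (rule infsum_cong_neutral) (auto simp: zero)
qed

lemma ell2_norm_le_iff:
  assumes "0 \<le> c"
  shows "ell2_norm Y f \<le> c \<longleftrightarrow> (\<Sum>\<^sub>\<infinity>w\<in>Y. (cmod (f w))\<^sup>2) \<le> c\<^sup>2"
proof -
  have "0 \<le> (\<Sum>\<^sub>\<infinity>w\<in>Y. (cmod (f w))\<^sup>2)"
    by (intro infsum_nonneg) simp
  then show ?thesis
    using assms unfolding ell2_norm_def by (metis real_sqrt_abs abs_of_nonneg real_sqrt_le_iff)
qed

lemma ell2_norm_eq_1_iff: "ell2_norm Y f = 1 \<longleftrightarrow> (\<Sum>\<^sub>\<infinity>w\<in>Y. (cmod (f w))\<^sup>2) = 1"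
  by (simp add: ell2_norm_def)

section \<open>Finite balls and countability\<close>

context Metric_space
begin

text \<open>The definition speaks of centres in \<open>M\<close> and positive radii; in all other
  cases the ball is empty or the single point \<open>x\<close>.\<close>

lemma bounded_geometry_finite_mcball:
  assumes "bounded_geometry"
  shows "finite (mcball x r)"
proof (cases "x \<in> M \<and> 0 < r")
  case True
  then show ?thesis
    using assms by (auto simp: bounded_geometry_def)
next
  case False
  then have "mcball x r \<subseteq> {x}"
    by auto (metis order.antisym nonneg not_less order.trans zero)
  then show ?thesis
    by (rule finite_subset) simp
qed

text \<open>The balls of integer radius around one point are finite and cover the space.\<close>

lemma bounded_geometry_countable:
  assumes "bounded_geometry"
  shows "countable M"
proof (cases "M = {}")
  case False
  then obtain a where a: "a \<in> M" by auto
  have "M \<subseteq> (\<Union>n. mcball a (real n))"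
    using a by (auto intro: real_arch_simple)
  moreover have "countable (\<Union>n. mcball a (real n))"
    by (intro countable_UN countableI_type countable_finite
        bounded_geometry_finite_mcball assms)
  ultimately show ?thesis
    by (rule countable_subset)
qed simp

section \<open>Limit of the unit vectors along a subsequence\<close>

text \<open>The exhaustion enters as eventual membership: for each point \<open>x\<close> the
  vectors \<open>\<xi> n x\<close> are then controlled for all large \<open>n\<close>, so that a
  limit in \<open>n\<close> inherits their bounds.\<close>

lemma strongly_embeddable_if_exhausted:
  fixes Xs :: "nat \<Rightarrow> 'a set"
  assumes geom: "bounded_geometry"
    and sub: "\<And>n. n \<ge> 1 \<Longrightarrow> Xs n \<subseteq> M"
    and exhausts: "\<And>x. x \<in> M \<Longrightarrow> \<forall>\<^sub>F n in sequentially. x \<in> Xs n"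
    and equi: "equi_strongly_embeddable {1..} Xs (\<lambda>_. d)"
  shows "strongly_embeddable"
  unfolding strongly_embeddable_def
proof (intro allI impI)
  fix R \<epsilon> :: real
  assume "R > 0" "\<epsilon> > 0"
  let ?T = "\<lambda>\<xi> S. SUP n\<in>{1..}. Metric_space.tail_sup (Xs n) d (\<xi> n) S"
  obtain \<xi> where
    unit: "\<And>n x. n \<ge> 1 \<Longrightarrow> x \<in> Xs n \<Longrightarrow> \<xi> n x \<in> ell2 (Xs n) \<and> ell2_norm (Xs n) (\<xi> n x) = 1"
    and var: "\<And>n. n \<ge> 1 \<Longrightarrow> Metric_space.has_variation (Xs n) d R \<epsilon> (\<xi> n)"
    and tail: "(?T \<xi> \<longlongrightarrow> 0) at_top"
    using equi[unfolded equi_strongly_embeddable_def, THEN spec, THEN mp, THEN spec, THEN mp,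
        OF \<open>R > 0\<close> \<open>\<epsilon> > 0\<close>]
    by (elim exE conjE) (rule that; simp)
  let ?T = "?T \<xi>"
  have mass: "(\<Sum>\<^sub>\<infinity>w\<in>M. (cmod (\<xi> n x w))\<^sup>2) = 1" if "n \<ge> 1" "x \<in> Xs n" for n x
    using unit[OF that] sub[OF that(1)] ell2_extend(2)[of "\<xi> n x" "Xs n" M]
    by (simp add: ell2_norm_eq_1_iff Int_absorb1)
  \<comment> \<open>The joint supremum yields a real bound with the same \<open>S\<close> for all
    \<open>n\<close> and \<open>x\<close>. The condition \<open>0 \<le> c\<close> matters, since
    \<open>ennreal\<close> sends negative reals to 0.\<close>
  have tail_le: "(\<Sum>\<^sub>\<infinity>w\<in>M - mcball x S. (cmod (\<xi> n x w))\<^sup>2) \<le> c"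
    if n: "n \<ge> 1" and x: "x \<in> Xs n" and c: "?T S \<le> ennreal c" "0 \<le> c" for n x S c
  proof -
    interpret Sub: Metric_space "Xs n" d
      using subspace sub[OF n] by blast
    have eq: "(M - mcball x S) \<inter> Xs n = Xs n - Sub.mcball x S"
      using x sub[OF n] by (auto simp: Sub.in_mcball)
    have "ennreal (\<Sum>\<^sub>\<infinity>w\<in>Xs n - Sub.mcball x S. (cmod (\<xi> n x w))\<^sup>2) \<le> Sub.tail_sup (\<xi> n) S"
      unfolding Sub.tail_sup_def using x by (rule SUP_upper)
    also have "\<dots> \<le> ?T S"
      using n by (intro SUP_upper) simp
    also note c(1)
    finally show ?thesis
      using ell2_extend(2)[of "\<xi> n x" "Xs n" "M - mcball x S"] unit[OF n x] c(2) eq by simp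
  qed

  \<comment> \<open>The default 0 replaces the uncontrolled values of \<open>\<xi> n x\<close> where
    \<open>x\<close> is not in \<open>Xs n\<close>, so that one bound holds for every
    \<open>n\<close>, as the diagonal argument requires.\<close>
  define f where "f n x w = (if n \<ge> 1 \<and> x \<in> Xs n then \<xi> n x w else 0)" for n x w
  have f_le: "cmod (f n x w) \<le> 1" if "w \<in> M" for n x w
  proof (cases "n \<ge> 1 \<and> x \<in> Xs n")
    case True
    \<comment> \<open>A single term is at most the total mass 1.\<close>
    then have "sum (\<lambda>w. (cmod (\<xi> n x w))\<^sup>2) {w} \<le> (\<Sum>\<^sub>\<infinity>w\<in>M. (cmod (\<xi> n x w))\<^sup>2)"
      using that unit ell2_extend(1)[of "\<xi> n x" "Xs n"] by (intro finite_sum_le_infsum) auto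
    then show ?thesis
      using True mass by (simp add: f_def power_le_one_iff)
  qed (auto simp: f_def)
  \<comment> \<open>Cantor's diagonal argument over the countable set \<open>M \<times> M\<close>,
    with all values in the closed unit disc.\<close>
  obtain k :: "nat \<Rightarrow> nat" where k: "strict_mono k"
    and conv: "\<And>p. p \<in> M \<times> M \<Longrightarrow> \<exists>l. (\<lambda>n. f (k n) (fst p) (snd p)) \<longlonglongrightarrow> l"
    using bounded_geometry_countable[OF geom] f_le
    by (rule_tac function_convergent_subsequence[of "M \<times> M" "\<lambda>n p. f n (fst p) (snd p)" 1])
       auto
  define \<beta> where "\<beta> x w = (if x \<in> M \<and> w \<in> M then lim (\<lambda>n. f (k n) x w) else 0)" for x w
  have lim: "(\<lambda>n. f (k n) x w) \<longlonglongrightarrow> \<beta> x w" if "x \<in> M" "w \<in> M" for x w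
    using conv[of "(x, w)"] that by (auto simp: \<beta>_def convergent_LIMSEQ_iff[symmetric] convergent_def)
  \<comment> \<open>From some index on, depending on \<open>x\<close>, the default no longer occurs
    and every bound on \<open>\<xi>\<close> applies to \<open>f\<close>; eventual bounds suffice for
    Fatou.\<close>
  have ev: "\<forall>\<^sub>F n in sequentially. k n \<ge> 1 \<and> x \<in> Xs (k n) \<and> f (k n) x = \<xi> (k n) x"
    if "x \<in> M" for x
  proof -
    have "\<forall>\<^sub>F n in sequentially. n \<ge> 1 \<and> x \<in> Xs n"
      using exhausts[OF that] eventually_ge_at_top[of 1] by eventually_elim auto
    then have "\<forall>\<^sub>F n in sequentially. k n \<ge> 1 \<and> x \<in> Xs (k n)"
      using eventually_subseq[OF k] by blast
    then show ?thesis
      by eventually_elim (auto simp: f_def)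
  qed

  have mass_le: "(\<lambda>w. (cmod (\<beta> x w))\<^sup>2) summable_on M" "(\<Sum>\<^sub>\<infinity>w\<in>M. (cmod (\<beta> x w))\<^sup>2) \<le> 1"
    if x: "x \<in> M" for x
  proof -
    have b: "\<forall>\<^sub>F n in sequentially. (\<lambda>w. (cmod (f (k n) x w))\<^sup>2) summable_on M \<and>
        (\<Sum>\<^sub>\<infinity>w\<in>M. (cmod (f (k n) x w))\<^sup>2) \<le> 1"
      using ev[OF x] by eventually_elim (use unit ell2_extend(1) mass in force)
    note Fatou = infsum_Fatou[OF _ _ b, of "\<lambda>w. (cmod (\<beta> x w))\<^sup>2"]
    show "(\<lambda>w. (cmod (\<beta> x w))\<^sup>2) summable_on M" "(\<Sum>\<^sub>\<infinity>w\<in>M. (cmod (\<beta> x w))\<^sup>2) \<le> 1"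
      by (rule Fatou; auto intro!: tendsto_intros lim x)+
  qed
  \<comment> \<open>Choose \<open>S\<close> independently of \<open>n\<close> with joint tail below
    \<open>\<delta>\<close>. For large \<open>n\<close> the ball of radius \<open>S\<close> carries
    mass at least \<open>1 - \<delta>\<close>, and this survives the limit because a sum over a
    finite ball commutes with it.\<close>
  have mass_ge: "1 \<le> (\<Sum>\<^sub>\<infinity>w\<in>M. (cmod (\<beta> x w))\<^sup>2)" if x: "x \<in> M" for x
  proof (rule field_le_epsilon)
    fix \<delta> :: real
    assume "\<delta> > 0"
    then have "\<forall>\<^sub>F S in at_top. ?T S < ennreal \<delta>"
      using tail by (intro order_tendstoD(2)) auto
    then obtain S where S: "?T S < ennreal \<delta>"
      by (auto dest: eventually_happens)
    have fin: "finite (mcball x S)"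
      using geom by (rule bounded_geometry_finite_mcball)
    have "1 - \<delta> \<le> (\<Sum>w\<in>mcball x S. (cmod (\<beta> x w))\<^sup>2)"
    proof (rule tendsto_lowerbound)
      show "(\<lambda>n. \<Sum>w\<in>mcball x S. (cmod (f (k n) x w))\<^sup>2)
          \<longlonglongrightarrow> (\<Sum>w\<in>mcball x S. (cmod (\<beta> x w))\<^sup>2)"
        by (intro tendsto_intros lim x) auto
      show "\<forall>\<^sub>F n in sequentially. 1 - \<delta> \<le> (\<Sum>w\<in>mcball x S. (cmod (f (k n) x w))\<^sup>2)"
        using ev[OF x]
      proof eventually_elim
        case (elim n)
        let ?g = "\<lambda>w. (cmod (\<xi> (k n) x w))\<^sup>2"
        have "?g summable_on A" for A
          using elim unit ell2_extend(1) by blast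
        then have "infsum ?g (mcball x S \<union> (M - mcball x S))
            = infsum ?g (mcball x S) + infsum ?g (M - mcball x S)"
          by (intro infsum_Un_disjoint) auto
        also have "mcball x S \<union> (M - mcball x S) = M"
          by auto
        also have "infsum ?g M = 1"
          using elim mass by blast
        also have "infsum ?g (mcball x S) = sum ?g (mcball x S)"
          using fin by (rule infsum_finite)
        finally show ?case
          using tail_le[of "k n" x S \<delta>] elim less_imp_le[OF S] \<open>\<delta> > 0\<close> by simp
      qed
    qed simp
    also have "\<dots> \<le> (\<Sum>\<^sub>\<infinity>w\<in>M. (cmod (\<beta> x w))\<^sup>2)"
      using fin mass_le(1)[OF x] by (intro finite_sum_le_infsum) auto
    finally show "1 \<le> (\<Sum>\<^sub>\<infinity>w\<in>M. (cmod (\<beta> x w))\<^sup>2) + \<delta>"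
      by simp
  qed
  have "\<beta> x \<in> ell2 M \<and> ell2_norm M (\<beta> x) = 1" if x: "x \<in> M" for x
    unfolding ell2_norm_eq_1_iff using mass_le[OF x] mass_ge[OF x]
    by (auto simp: ell2_def \<beta>_def)
  moreover have "has_variation R \<epsilon> \<beta>"
    unfolding has_variation_def
  proof (intro ballI impI)
    fix x y
    assume x: "x \<in> M" and y: "y \<in> M" and xy: "d x y \<le> R"
    \<comment> \<open>For large \<open>n\<close> both points lie in \<open>Xs (k n)\<close>, where
      the variation bound holds; it is squared to become a bound on sums.\<close>
    have b: "\<forall>\<^sub>F n in sequentially. (\<lambda>w. (cmod (f (k n) x w - f (k n) y w))\<^sup>2) summable_on M \<and>
        (\<Sum>\<^sub>\<infinity>w\<in>M. (cmod (f (k n) x w - f (k n) y w))\<^sup>2) \<le> \<epsilon>\<^sup>2"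
      using ev[OF x] ev[OF y]
    proof eventually_elim
      case (elim n)
      interpret Sub: Metric_space "Xs (k n)" d
        using subspace sub elim by blast
      let ?g = "\<lambda>w. \<xi> (k n) x w - \<xi> (k n) y w"
      have g: "?g \<in> ell2 (Xs (k n))"
        using elim unit by (intro ell2_diff) auto
      have "ell2_norm (Xs (k n)) ?g \<le> \<epsilon>"
        using var[of "k n"] elim xy by (simp add: Sub.has_variation_def)
      then have "(\<Sum>\<^sub>\<infinity>w\<in>Xs (k n). (cmod (?g w))\<^sup>2) \<le> \<epsilon>\<^sup>2"
        using \<open>\<epsilon> > 0\<close> by (simp add: ell2_norm_le_iff)
      then show ?case
        using ell2_extend[OF g, of M] sub elim by (simp add: Int_absorb1)
    qed
    have "(\<Sum>\<^sub>\<infinity>w\<in>M. (cmod (\<beta> x w - \<beta> y w))\<^sup>2) \<le> \<epsilon>\<^sup>2"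
      by (rule infsum_Fatou(2)[OF _ _ b]) (auto intro!: tendsto_intros lim x y)
    then show "ell2_norm M (\<lambda>w. \<beta> x w - \<beta> y w) \<le> \<epsilon>"
      using \<open>\<epsilon> > 0\<close> by (simp add: ell2_norm_le_iff)
  qed
  moreover have "(tail_sup \<beta> \<longlongrightarrow> 0) at_top"
  proof (rule tendsto_sandwich[OF _ _ tendsto_const tail])
    \<comment> \<open>Fatou is applied outside the ball with \<open>S\<close> fixed. A finite value
      of the joint tail serves as the constant; an infinite one bounds everything. As the comparison
      holds for every \<open>S\<close>, squeezing gives the limit.\<close>
    have "tail_sup \<beta> S \<le> ?T S" for S
    proof (cases "?T S")
      case (real c)
      have "(\<Sum>\<^sub>\<infinity>w\<in>M - mcball x S. (cmod (\<beta> x w))\<^sup>2) \<le> c" if x: "x \<in> M" for x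
      proof -
        have b: "\<forall>\<^sub>F n in sequentially.
            (\<lambda>w. (cmod (f (k n) x w))\<^sup>2) summable_on (M - mcball x S) \<and>
            (\<Sum>\<^sub>\<infinity>w\<in>M - mcball x S. (cmod (f (k n) x w))\<^sup>2) \<le> c"
          using ev[OF x] by eventually_elim (use unit ell2_extend(1) tail_le real in force)
        show ?thesis
          by (rule infsum_Fatou(2)[OF _ _ b]) (auto intro!: tendsto_intros lim x)
      qed
      then show ?thesis
        unfolding tail_sup_def real(2) by (intro SUP_least ennreal_leI) auto
    next
      case top
      show ?thesis
        unfolding top by (rule top_greatest)
    qed
    then show "\<forall>\<^sub>F S in at_top. tail_sup \<beta> S \<le> ?T S"
      by simp
  qed simp
  ultimately show "\<exists>\<beta>. (\<forall>x\<in>M. \<beta> x \<in> ell2 M \<and> ell2_norm M (\<beta> x) = 1) \<and>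
      has_variation R \<epsilon> \<beta> \<and> (tail_sup \<beta> \<longlongrightarrow> 0) at_top"
    by blast
qed

end

section \<open>Increasing exhaustions\<close>

theorem proposition3p3:
  fixes X :: "'a set" and d :: "'a \<Rightarrow> 'a \<Rightarrow> real" and Xs :: "nat \<Rightarrow> 'a set"
  assumes "Metric_space X d"
    and "Metric_space.uniformly_discrete X d"
    and "Metric_space.bounded_geometry X d"
    and "\<And>n. n \<ge> 1 \<Longrightarrow> Xs n \<subseteq> X \<and> Metric_space.mbounded X d (Xs n)"
    and "\<And>n. n \<ge> 1 \<Longrightarrow> Xs n \<subseteq> Xs (Suc n)"
    and "X = (\<Union>n\<in>{1..}. Xs n)"
    and "\<And>B. B \<subseteq> X \<Longrightarrow> Metric_space.mbounded X d B \<Longrightarrow> \<exists>n\<ge>1. B \<subseteq> Xs n"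
    and "equi_strongly_embeddable {1..} Xs (\<lambda>_. d)"
  shows "Metric_space.strongly_embeddable X d"
proof (rule Metric_space.strongly_embeddable_if_exhausted)
  fix x
  assume "x \<in> X"
  then obtain m where m: "m \<ge> 1" "x \<in> Xs m"
    using assms(6) by auto
  \<comment> \<open>Monotonicity turns membership in one \<open>Xs m\<close> into membership in all
    later sets.\<close>
  have "x \<in> Xs n" if "n \<ge> m" for n
    using that
  proof (induction n rule: dec_induct)
    case (step n)
    with m assms(5)[of n] show ?case
      by auto
  qed (rule m)
  then show "\<forall>\<^sub>F n in sequentially. x \<in> Xs n"
    unfolding eventually_sequentially by blast
qed (use assms in auto)

end
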